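(* Let $m$ and $F$ be positive integers such that $m<F$ and $m\nmid F$. Then $$\mathscr{R}(F,m)=\{S\mid S\text{ is a numerical semigroup},\ \mathrm{F}(S)=F\text{ and }\mathrm{m}(S)=m\}$$ is a ratio-covariety.
   Context: $\mathbb{N}$ is the set of nonnegative integers. A numerical semigroup is a submonoid $S$ of $(\mathbb{N},+)$ with $\mathbb{N}\setminus S$ finite. Its Frobenius number $\mathrm{F}(S)$ is the largest integer not in $S$, and its multiplicity is $\mathrm{m}(S)=\min(S\setminus\{0\})$. If $S\neq\mathbb{N}$, the ratio of $S$ is $\mathrm{r}(S)=\min\{s\in S\mid \mathrm{m}(S)\nmid s\}$ (equivalently, the smallest minimal generator of $S$ different from $\mathrm{m}(S)$). A ratio-covariety is a nonempty family $\mathscr{R}$ of numerical semigroups such that: 1) $\mathscr{R}$ has a minimum with respect to inclusion, denoted $\min(\mathscr{R})$; 2) if $S,T\in\mathscr{R}$ then $S\cap T\in\mathscr{R}$; 3) if $S\in\mathscr{R}$ and $S\neq\min(\mathscr{R})$, then $S\setminus\{\mathrm{r}(S)\}\in\mathscr{R}$ (in particular $\mathrm{r}(S)$ is defined, i.e. $S\neq\mathbb{N}$). *)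

theory Defs
  imports Main
begin

definition numerical_semigroup :: "nat set \<Rightarrow> bool" where
  "numerical_semigroup S \<longleftrightarrow>
     0 \<in> S \<and> (\<forall>x\<in>S. \<forall>y\<in>S. x + y \<in> S) \<and> finite (UNIV - S)"

text \<open>The Frobenius number is the largest \<^emph>\<open>integer\<close> outside \<open>S\<close>, so it is \<open>- 1\<close> for
  \<open>S = UNIV\<close>. \<open>GREATEST\<close> is used because the set of integers outside \<open>S\<close> is infinite,
  so that \<open>Max\<close> would be unspecified.\<close>

definition frobenius :: "nat set \<Rightarrow> int" where
  "frobenius S = (GREATEST z. z \<notin> int ` S)"

definition multiplicity :: "nat set \<Rightarrow> nat" where
  "multiplicity S = (LEAST s. s \<in> S - {0})"

text \<open>Meaningful only for numerical semigroups \<open>S \<noteq> UNIV\<close>; for \<open>S = UNIV\<close> the multiplicity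
  is 1 and the set of candidates is empty.\<close>

definition ratio :: "nat set \<Rightarrow> nat" where
  "ratio S = (LEAST s. s \<in> S \<and> \<not> multiplicity S dvd s)"

text \<open>\<open>LEAST M. M \<in> R\<close> is taken with respect to inclusion, the order on sets; it is
  well-defined by the preceding clause on the existence of a minimum. The conjunct
  \<open>S \<noteq> UNIV\<close> makes explicit that the ratio of \<open>S\<close> is defined.\<close>

definition ratio_covariety :: "nat set set \<Rightarrow> bool" where
  "ratio_covariety R \<longleftrightarrow>
     R \<noteq> {} \<and>
     (\<forall>S\<in>R. numerical_semigroup S) \<and>
     (\<exists>M\<in>R. \<forall>S\<in>R. M \<subseteq> S) \<and>
     (\<forall>S\<in>R. \<forall>T\<in>R. S \<inter> T \<in> R) \<and>
     (\<forall>S\<in>R. S \<noteq> (LEAST M. M \<in> R) \<longrightarrow> S \<noteq> UNIV \<and> S - {ratio S} \<in> R)"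

definition semigroups_with_frobenius_mult :: "nat \<Rightarrow> nat \<Rightarrow> nat set set" where
  "semigroups_with_frobenius_mult F m =
     {S. numerical_semigroup S \<and> frobenius S = int F \<and> multiplicity S = m}"

end

theory Submission
  imports Defs
begin

text \<open>
  Membership in the family amounts to elementary conditions on a submonoid \<open>S\<close>: it omits \<open>F\<close>,
  contains everything above \<open>F\<close>, contains \<open>m\<close>, and has no smaller positive element
  (\<open>mem_semigroups_with_frobenius_mult_iff\<close>). These conditions are visibly stable under
  intersection. They force \<open>S\<close> to contain the multiples of \<open>m\<close> and the numbers above \<open>F\<close>;
  because \<open>m\<close> does not divide \<open>F\<close>, these elements already form a member, which is the minimum.

  A member \<open>S\<close> other than this minimum has an element below \<open>F\<close> that is not a multiple of \<open>m\<close>, so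
  its ratio \<open>r\<close> lies below \<open>F\<close>. Every element of \<open>S\<close> smaller than \<open>r\<close> is a multiple of \<open>m\<close>, and
  \<open>r\<close> is not, so \<open>r\<close> is no sum of other elements and can be removed
  (\<open>closed_under_add_remove_ratio\<close>). Since \<open>r < F\<close> and \<open>r \<noteq> m\<close>, the removal changes neither
  the Frobenius number nor the multiplicity.
\<close>

lemma frobenius_eq_iff:
  assumes "finite (UNIV - S)"
  shows "frobenius S = int F \<longleftrightarrow> F \<notin> S \<and> (\<forall>x>F. x \<in> S)"
proof
  assume F: "F \<notin> S \<and> (\<forall>x>F. x \<in> S)"
  have "z \<le> int F" if "z \<notin> int ` S" for z
  proof (rule ccontr)
    assume "\<not> z \<le> int F"
    then have "nat z \<in> S" "z = int (nat z)" using F by auto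
    with that show False by blast
  qed
  then show "frobenius S = int F"
    unfolding frobenius_def using F by (intro Greatest_equality) auto
next
  assume eq: "frobenius S = int F"
  \<comment> \<open>\<open>GREATEST\<close> says nothing until a greatest gap is known to exist; since \<open>-1\<close> is always a gap,
    only finitely many integers compete.\<close>
  define G where "G = Max (insert (- 1) (int ` (UNIV - S)))"
  have fin: "finite (insert (- 1) (int ` (UNIV - S)))" using assms by simp
  have "G \<in> insert (- 1) (int ` (UNIV - S))"
    unfolding G_def using fin by (intro Max_in) auto
  then have notin: "G \<notin> int ` S" by auto
  have le: "z \<le> G" if "z \<notin> int ` S" for z
  proof (cases "z < 0")
    case True
    have "- 1 \<le> G" unfolding G_def using fin by (intro Max_ge) auto
    with True show ?thesis by simp
  next
    case False
    then have z: "z = int (nat z)" by simp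
    with that have "nat z \<in> UNIV - S" by blast
    with z have "z \<in> insert (- 1) (int ` (UNIV - S))" by blast
    then show ?thesis unfolding G_def using fin by (intro Max_ge)
  qed
  have "frobenius S = G"
    unfolding frobenius_def using notin le by (intro Greatest_equality) auto
  with eq have G: "G = int F" by simp
  have "x \<in> S" if "x > F" for x
  proof (rule ccontr)
    assume "x \<notin> S"
    then have "int x \<notin> int ` S" by auto
    with le[of "int x"] that G show False by simp
  qed
  with notin G show "F \<notin> S \<and> (\<forall>x>F. x \<in> S)" by auto
qed

lemma multiplicity_eq_iff:
  assumes "finite (UNIV - S)"
  shows "multiplicity S = m \<longleftrightarrow> 0 < m \<and> m \<in> S \<and> (\<forall>x\<in>S. 0 < x \<longrightarrow> m \<le> x)"
proof
  assume eq: "multiplicity S = m"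
  have "infinite S"
    using assms by (metis finite_Diff2 infinite_UNIV_nat)
  then have "\<exists>s. s \<in> S - {0}"
    using infinite_remove[of S 0] by (metis ex_in_conv finite.emptyI)
  then have "m \<in> S - {0}"
    using eq unfolding multiplicity_def by (metis (mono_tags, lifting) LeastI_ex)
  moreover have "m \<le> x" if "x \<in> S - {0}" for x
    using that eq unfolding multiplicity_def by (metis (mono_tags, lifting) Least_le)
  ultimately show "0 < m \<and> m \<in> S \<and> (\<forall>x\<in>S. 0 < x \<longrightarrow> m \<le> x)" by auto
next
  assume "0 < m \<and> m \<in> S \<and> (\<forall>x\<in>S. 0 < x \<longrightarrow> m \<le> x)"
  then show "multiplicity S = m"
    unfolding multiplicity_def by (intro Least_equality) auto
qed

lemma mem_semigroups_with_frobenius_mult_iff: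
  "S \<in> semigroups_with_frobenius_mult F m \<longleftrightarrow>
     0 \<in> S \<and> (\<forall>x\<in>S. \<forall>y\<in>S. x + y \<in> S) \<and> F \<notin> S \<and> (\<forall>x>F. x \<in> S) \<and>
     0 < m \<and> m \<in> S \<and> (\<forall>x\<in>S. 0 < x \<longrightarrow> m \<le> x)"
proof (cases "finite (UNIV - S)")
  case True
  then show ?thesis
    unfolding semigroups_with_frobenius_mult_def numerical_semigroup_def
    by (auto simp: frobenius_eq_iff multiplicity_eq_iff)
next
  case False
  have "\<not> (\<forall>x>F. x \<in> S)"
  proof
    assume "\<forall>x>F. x \<in> S"
    then have "UNIV - S \<subseteq> {..F}" using not_less by blast
    with False show False using finite_subset by blast
  qed
  with False show ?thesis
    by (auto simp: semigroups_with_frobenius_mult_def numerical_semigroup_def)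
qed

lemma multiples_subset:
  fixes m :: nat
  assumes "0 \<in> S" "\<forall>x\<in>S. \<forall>y\<in>S. x + y \<in> S" "m \<in> S"
  shows "{x. m dvd x} \<subseteq> S"
proof -
  have "m * k \<in> S" for k
    using assms by (induction k) auto
  then show ?thesis by (auto elim!: dvdE)
qed

text \<open>If \<open>r = x + y\<close> with \<open>x\<close> and \<open>y\<close> both different from \<open>r\<close>, then both are smaller than \<open>r\<close>,
  hence multiples of the multiplicity by minimality of \<open>r\<close>; but \<open>r\<close> is not such a multiple.\<close>

lemma closed_under_add_remove_ratio:
  assumes closed: "\<forall>x\<in>S. \<forall>y\<in>S. x + y \<in> S"
    and ex: "\<exists>s\<in>S. \<not> multiplicity S dvd s"
  shows "\<forall>x\<in>S - {ratio S}. \<forall>y\<in>S - {ratio S}. x + y \<in> S - {ratio S}"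
proof (intro ballI)
  fix x y assume xy: "x \<in> S - {ratio S}" "y \<in> S - {ratio S}"
  have nd: "\<not> multiplicity S dvd ratio S"
    unfolding ratio_def using LeastI_ex[of "\<lambda>s. s \<in> S \<and> \<not> multiplicity S dvd s"] ex by blast
  have below: "multiplicity S dvd z" if "z \<in> S" "z < ratio S" for z
    using that not_less_Least[of z "\<lambda>s. s \<in> S \<and> \<not> multiplicity S dvd s"]
    unfolding ratio_def by blast
  have "x + y \<noteq> ratio S"
  proof
    assume sum: "x + y = ratio S"
    with xy have "x < ratio S" "y < ratio S"
      by (auto intro: le_neq_implies_less)
    with below xy have "multiplicity S dvd x + y" by auto
    with sum nd show False by simp
  qed
  with xy closed show "x + y \<in> S - {ratio S}" by auto
qed

theorem proposition3p3:
  fixes m F :: nat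
  assumes "0 < m" and "0 < F" and "m < F" and "\<not> m dvd F"
  shows "ratio_covariety (semigroups_with_frobenius_mult F m)"
proof -
  let ?R = "semigroups_with_frobenius_mult F m"
  define M where "M = {x. m dvd x} \<union> {F<..}"
  have M_in: "M \<in> ?R"
    using assms unfolding mem_semigroups_with_frobenius_mult_iff M_def
    by (auto dest: dvd_imp_le)
  have M_sub: "M \<subseteq> S" if "S \<in> ?R" for S
    using that multiples_subset[of S m]
    unfolding mem_semigroups_with_frobenius_mult_iff M_def by auto
  have least: "(LEAST M. M \<in> ?R) = M"
    using M_in M_sub by (intro Least_equality)
  have inter: "S \<inter> T \<in> ?R" if "S \<in> ?R" "T \<in> ?R" for S T
    using that unfolding mem_semigroups_with_frobenius_mult_iff by auto
  have remove: "S \<noteq> UNIV \<and> S - {ratio S} \<in> ?R" if S: "S \<in> ?R" and "S \<noteq> M" for S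
  proof -
    have mult: "multiplicity S = m"
      using S unfolding semigroups_with_frobenius_mult_def by simp
    have props: "0 \<in> S" "\<forall>x\<in>S. \<forall>y\<in>S. x + y \<in> S" "F \<notin> S" "\<forall>x>F. x \<in> S"
        "m \<in> S" "\<forall>x\<in>S. 0 < x \<longrightarrow> m \<le> x"
      using S unfolding mem_semigroups_with_frobenius_mult_iff by auto
    obtain s where s: "s \<in> S" "\<not> m dvd s" "s \<le> F"
      using M_sub[OF S] \<open>S \<noteq> M\<close> unfolding M_def by fastforce
    have r: "ratio S \<in> S" "\<not> m dvd ratio S"
      using LeastI[of "\<lambda>s. s \<in> S \<and> \<not> m dvd s" s] s unfolding ratio_def mult by auto
    have "ratio S \<le> s"
      unfolding ratio_def mult using s by (intro Least_le) auto
    moreover have "ratio S \<noteq> F" using r(1) props(3) by metis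
    ultimately have lt: "ratio S < F" using s(3) by linarith
    have ne: "0 \<noteq> ratio S" "m \<noteq> ratio S"
      using r(2) dvd_0_right[of m] dvd_refl[of m] by metis+
    have closed: "\<forall>x\<in>S - {ratio S}. \<forall>y\<in>S - {ratio S}. x + y \<in> S - {ratio S}"
      using s(1,2) by (intro closed_under_add_remove_ratio props(2)) (auto simp: mult)
    have "\<forall>x>F. x \<in> S - {ratio S}" using props(4) lt by auto
    then have "S - {ratio S} \<in> ?R"
      unfolding mem_semigroups_with_frobenius_mult_iff
      using closed props(1,3,5,6) ne \<open>0 < m\<close> by blast
    then show ?thesis using props(3) by blast
  qed
  have "numerical_semigroup S" if "S \<in> ?R" for S
    using that unfolding semigroups_with_frobenius_mult_def by simp
  then show ?thesis
    unfolding ratio_covariety_def least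
    using M_in M_sub by (intro conjI ballI impI inter remove) auto
qed

end
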